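(* Let $M$ and $\hat M$ be the one-sided and two-sided Morse sequences, and let $\sigma$ be the shift. (1) In the two-sided system $(\overline{O^+(\hat M)},\mu,\sigma)$, where $\mu$ is its unique $\sigma$-invariant probability measure, let $\Gamma=\{\omega : \omega_0=1\}$ and let $\chi_\Gamma$ be its characteristic function. Then $\mu\left(\mathcal{H}^{\chi_\Gamma}_\sigma(\mathbb{N})\right)\ge\mu\left(\mathcal{H}^{\chi_\Gamma}_\sigma(\mathbb{Z})\right)>0$. (2) In the one-sided system $(\overline{O^+(M)},\mu,\sigma)$, where $\mu$ is its unique $\sigma$-invariant probability measure, and again $\Gamma=\{\omega:\omega_0=1\}$, one has $\mu\left(\mathcal{H}^{\chi_\Gamma}_\sigma(\mathbb{N})\right)>0$.
   Context: For a finite binary word $A$, let $\overline{A}$ be obtained by exchanging $0$ and $1$. Set $M(0)=0$ and $M(i+1)=M(i)\overline{M(i)}$ (concatenation). The one-sided Morse sequence $M\in\{0,1\}^{\mathbb{N}}$ is the sequence whose initial word of length $2^n$ is $M(n)$ for all $n$. The two-sided Morse sequence $\hat M\in\{0,1\}^{\mathbb{Z}}$ is given by $\hat M_i=M_i$ for $i\ge 0$ and $\hat M_{-i-1}=M_i$ for $i\ge 0$. The shift is $\sigma(X)_n=X_{n+1}$, and $\overline{O^+(X)}$ is the closure (in the product topology) of $\{\sigma^nX : n\ge 0\}$. It is well known that the systems generated by $M$ and by $\hat M$ are uniquely ergodic; the invariant probability measure satisfies $\mu(\Gamma)=\tfrac12$. For a probability measure preserving system $(\Omega,\mu,T)$ and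 $f\in L^1(\Omega,\mu)$, let $S_0=0$, $S_n(\omega)=\sum_{i=0}^{n-1}f(T^i\omega)$ for $n>0$, and, if $T$ is invertible, $S_n(\omega)=-\sum_{i=n}^{-1}f(T^i\omega)$ for $n<0$. The heavy sets are $\mathcal{H}_T^f(\mathbb{N})=\{\omega : S_i(\omega)\ge i\int_\Omega f\,d\mu \text{ for all } i\ge 0\}$ and, for $T$ invertible, $\mathcal{H}_T^f(\mathbb{Z})=\{\omega : S_i(\omega)\ge i\int_\Omega f\,d\mu\text{ for all } i\in\mathbb{Z}\}$. *)

theory Defs
  imports "HOL-Probability.Probability"
begin

(* Binary sequences take values in bool, with True for the symbol 1 and False for 0.
   Functions into bool carry the product topology of the discrete topology. *)

primrec morse_word :: "nat \<Rightarrow> bool list" where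
  "morse_word 0 = [False]"
| "morse_word (Suc i) = morse_word i @ map Not (morse_word i)"

(* morse_word i has length 2 ^ i > i; see map_morse_seq. *)
definition morse_seq :: "nat \<Rightarrow> bool" where
  "morse_seq i = morse_word i ! i"

lemma length_morse_word [simp]: "length (morse_word n) = 2 ^ n"
  by (induction n) auto

lemma nth_morse_word_mono:
  assumes "m \<le> n" and "i < 2 ^ m"
  shows "morse_word n ! i = morse_word m ! i"
  using assms(1)
proof (induction n rule: dec_induct)
  case base
  show ?case ..
next
  case (step k)
  have "(2::nat) ^ m \<le> 2 ^ k" using step.hyps by (intro power_increasing) auto
  with assms(2) have "i < 2 ^ k" by linarith
  then show ?case using step.IH by (simp add: nth_append)
qed

lemma map_morse_seq: "map morse_seq [0..<2 ^ n] = morse_word n"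
proof (rule nth_equalityI)
  fix i assume "i < length (map morse_seq [0..<2 ^ n])"
  then have i: "i < 2 ^ n" by simp
  have "morse_word i ! i = morse_word n ! i"
    using nth_morse_word_mono[of i n i] nth_morse_word_mono[of n i i] i less_exp[of i]
    by (cases "i \<le> n") auto
  then show "map morse_seq [0..<2 ^ n] ! i = morse_word n ! i"
    using i by (simp add: morse_seq_def)
qed simp

definition morse_seq_two_sided :: "int \<Rightarrow> bool" where
  "morse_seq_two_sided i = (if i \<ge> 0 then morse_seq (nat i) else morse_seq (nat (- i - 1)))"

(* Used with index type nat (one-sided) and int (two-sided). *)
definition shift :: "('i::{plus,one} \<Rightarrow> 'a) \<Rightarrow> 'i \<Rightarrow> 'a" where
  "shift X = (\<lambda>n. X (n + 1))"

definition forward_orbit_closure ::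
    "('a::topological_space \<Rightarrow> 'a) \<Rightarrow> 'a \<Rightarrow> 'a set" where
  "forward_orbit_closure T x = closure (range (\<lambda>n. (T ^^ n) x))"

(* T-invariant Borel probability measures on the subspace X. *)
definition invariant_prob ::
    "'a::topological_space set \<Rightarrow> ('a \<Rightarrow> 'a) \<Rightarrow> 'a measure \<Rightarrow> bool" where
  "invariant_prob X T \<mu> \<longleftrightarrow>
     prob_space \<mu> \<and> sets \<mu> = sets (restrict_space borel X) \<and>
     T \<in> measurable \<mu> \<mu> \<and> distr \<mu> \<mu> T = \<mu>"

definition birkhoff_sum :: "('a \<Rightarrow> 'a) \<Rightarrow> ('a \<Rightarrow> real) \<Rightarrow> nat \<Rightarrow> 'a \<Rightarrow> real" where
  "birkhoff_sum T f n \<omega> = (\<Sum>i<n. f ((T ^^ i) \<omega>))"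

(* Integer iterates of a bijection T of \<Omega>. *)
definition int_iterate :: "'a set \<Rightarrow> ('a \<Rightarrow> 'a) \<Rightarrow> int \<Rightarrow> 'a \<Rightarrow> 'a" where
  "int_iterate \<Omega> T i =
     (if i \<ge> 0 then T ^^ nat i else inv_into \<Omega> T ^^ nat (- i))"

definition birkhoff_sum_int ::
    "'a set \<Rightarrow> ('a \<Rightarrow> 'a) \<Rightarrow> ('a \<Rightarrow> real) \<Rightarrow> int \<Rightarrow> 'a \<Rightarrow> real" where
  "birkhoff_sum_int \<Omega> T f n \<omega> =
     (if n \<ge> 0 then (\<Sum>i\<in>{0..<n}. f (int_iterate \<Omega> T i \<omega>))
      else - (\<Sum>i\<in>{n..-1}. f (int_iterate \<Omega> T i \<omega>)))"

definition heavy_nat :: "'a measure \<Rightarrow> ('a \<Rightarrow> 'a) \<Rightarrow> ('a \<Rightarrow> real) \<Rightarrow> 'a set" where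
  "heavy_nat \<mu> T f =
     {\<omega> \<in> space \<mu>. \<forall>i::nat. birkhoff_sum T f i \<omega> \<ge> real i * (\<integral>x. f x \<partial>\<mu>)}"

definition heavy_int :: "'a measure \<Rightarrow> ('a \<Rightarrow> 'a) \<Rightarrow> ('a \<Rightarrow> real) \<Rightarrow> 'a set" where
  "heavy_int \<mu> T f =
     {\<omega> \<in> space \<mu>. \<forall>i::int.
        birkhoff_sum_int (space \<mu>) T f i \<omega> \<ge> real_of_int i * (\<integral>x. f x \<partial>\<mu>)}"

end

theory Submission
  imports Defs
begin

text \<open>
  The Morse sequence is a concatenation of the blocks 01 and 10, so every point of the orbit closure
  splits into such blocks, placed either at even or at odd positions. Hence the number of ones among
  the first \<open>n\<close> symbols differs from \<open>n / 2\<close> by at most 1, which forces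
  \<open>\<mu>(\<Gamma>) = 1 / 2\<close> for every invariant \<open>\<mu>\<close>. A point whose blocks start at odd
  positions and whose symbol at 0 is 1 (hence whose symbol at -1 is 0) is heavy in both directions:
  its excess of ones starts at 1 and then only fluctuates by at most 1, and symmetrically to the
  left. Every orbit meets the set of these points within 6 steps, so it has positive measure.
\<close>

section \<open>The Morse sequence\<close>

lemma nth_morse_word: "i < 2 ^ n \<Longrightarrow> morse_word n ! i = morse_seq i"
  by (simp flip: map_morse_seq)

lemma morse_seq_0: "\<not> morse_seq 0"
  by (simp add: morse_seq_def)

lemma morse_seq_add_power:
  assumes "i < 2 ^ n"
  shows "morse_seq (2 ^ n + i) \<longleftrightarrow> \<not> morse_seq i"
proof -
  have "morse_seq (2 ^ n + i) = morse_word (Suc n) ! (2 ^ n + i)"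
    using assms by (intro nth_morse_word [symmetric]) simp
  also have "\<dots> = (\<not> morse_word n ! i)"
    using assms by (simp add: nth_append)
  finally show ?thesis
    using assms by (simp add: nth_morse_word)
qed

text \<open>The symbol at \<open>i\<close> is the parity of the binary digit sum of
  \<open>i\<close>. The induction strips the leading digit, which flips the symbol at
  \<open>i\<close> and, shifted by one place, the symbols at \<open>2 * i\<close> and
  \<open>2 * i + 1\<close>.\<close>

lemma morse_seq_double:
  "morse_seq (2 * i) = morse_seq i \<and> morse_seq (2 * i + 1) = (\<not> morse_seq i)"
proof (induction i rule: less_induct)
  case (less i)
  show ?case
  proof (cases "i = 0")
    case True
    then show ?thesis
      using morse_seq_add_power [of 0 0] by (simp add: morse_seq_0)
  next
    case False
    then obtain n where n: "2 ^ n \<le> i" "i < 2 ^ (n + 1)"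
      using ex_power_ivl1 [of 2 i] by auto
    define r where "r = i - 2 ^ n"
    have i: "i = 2 ^ n + r" and r: "r < 2 ^ n" and "r < i"
      using n by (auto simp: r_def)
    have "morse_seq (2 * i) = (\<not> morse_seq (2 * r))"
      "morse_seq (2 * i + 1) = (\<not> morse_seq (2 * r + 1))"
      "morse_seq i = (\<not> morse_seq r)"
      using morse_seq_add_power [of "2 * r" "Suc n"] morse_seq_add_power [of "2 * r + 1" "Suc n"]
        morse_seq_add_power [of r n] r by (simp_all add: i algebra_simps)
    then show ?thesis
      using less [OF \<open>r < i\<close>] by simp
  qed
qed

lemma morse_seq_even [simp]: "morse_seq (2 * i) = morse_seq i"
  and morse_seq_odd [simp]: "morse_seq (Suc (2 * i)) = (\<not> morse_seq i)"
  using morse_seq_double [of i] by auto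

text \<open>The binary digits of \<open>q\<close> and \<open>m\<close> do not overlap, so digit
  parities add. The induction removes the lowest digit.\<close>

lemma morse_seq_block:
  "m < 2 ^ k \<Longrightarrow> morse_seq (q * 2 ^ k + m) = (morse_seq q \<noteq> morse_seq m)"
proof (induction k arbitrary: m)
  case 0
  then show ?case by (simp add: morse_seq_0)
next
  case (Suc k)
  have IH: "morse_seq (q * 2 ^ k + m div 2) = (morse_seq q \<noteq> morse_seq (m div 2))"
    using Suc.prems by (intro Suc.IH) auto
  show ?case
  proof (cases "even m")
    case True
    then obtain j where m: "m = 2 * j" ..
    have "q * 2 ^ Suc k + m = 2 * (q * 2 ^ k + j)" by (simp add: m)
    then show ?thesis using IH by (simp only: morse_seq_even) (simp add: m)
  next
    case False
    then obtain j where m: "m = Suc (2 * j)" by (auto elim: oddE)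
    have "q * 2 ^ Suc k + m = Suc (2 * (q * 2 ^ k + j))" by (simp add: m)
    then show ?thesis using IH by (simp only: morse_seq_odd) (simp add: m)
  qed
qed

text \<open>Reflection complements all \<open>k\<close> binary digits, which changes the parity of
  the digit sum exactly when \<open>k\<close> is odd.\<close>

lemma morse_seq_reflect:
  "i < 2 ^ k \<Longrightarrow> morse_seq (2 ^ k - 1 - i) = (morse_seq i \<noteq> odd k)"
proof (induction k arbitrary: i)
  case 0
  then show ?case by simp
next
  case (Suc k)
  have IH: "morse_seq (2 ^ k - 1 - i div 2) = (morse_seq (i div 2) \<noteq> odd k)"
    using Suc.prems by (intro Suc.IH) auto
  show ?case
  proof (cases "even i")
    case True
    then obtain j where i: "i = 2 * j" ..
    have "2 ^ Suc k - 1 - i = Suc (2 * (2 ^ k - 1 - j))"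
      using Suc.prems by (simp add: i)
    then show ?thesis using IH by (simp only: morse_seq_odd) (simp add: i)
  next
    case False
    then obtain j where i: "i = Suc (2 * j)" by (auto elim: oddE)
    have "2 ^ Suc k - 1 - i = 2 * (2 ^ k - 1 - j)"
      using Suc.prems by (simp add: i)
    then show ?thesis using IH by (simp only: morse_seq_even) (simp add: i)
  qed
qed

text \<open>Both sides are the complement of the symbol at \<open>i\<close>: the aligned blocks of
  length 4 are 0110 and 1001.\<close>

lemma morse_seq_middle: "morse_seq (4 * i + 1) = morse_seq (4 * i + 2)"
  using morse_seq_odd [of "2 * i"] morse_seq_even [of "2 * i + 1"] by simp

section \<open>Block structure and recurrence of the two-sided sequence\<close>

lemma morse_seq_two_sided_of_nat [simp]: "morse_seq_two_sided (int n) = morse_seq n"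
  by (simp add: morse_seq_two_sided_def)

lemma morse_seq_two_sided_neg [simp]: "morse_seq_two_sided (- 1 - int n) = morse_seq n"
  by (simp add: morse_seq_two_sided_def)

lemma int_cases_neg: obtains n where "i = int n" | n where "i = - 1 - int n"
  by (cases i) auto

text \<open>The reflection exchanging \<open>n\<close> and \<open>- 1 - n\<close> maps aligned pairs
  to aligned pairs with their entries swapped, so negative positions inherit the pairing. The same
  works for the middles of aligned blocks of length 4.\<close>

lemma morse_seq_two_sided_pair: "morse_seq_two_sided (2 * i) \<noteq> morse_seq_two_sided (2 * i + 1)"
proof (cases i rule: int_cases_neg)
  case (1 n)
  then show ?thesis
    using morse_seq_two_sided_of_nat [of "2 * n"] morse_seq_two_sided_of_nat [of "2 * n + 1"]
      morse_seq_odd [of n] morse_seq_even [of n]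
    by (simp add: algebra_simps del: morse_seq_odd morse_seq_even)
next
  case (2 n)
  have "2 * i = - 1 - int (Suc (2 * n))" "2 * i + 1 = - 1 - int (2 * n)"
    by (simp_all add: 2)
  then show ?thesis
    by (simp only: morse_seq_two_sided_neg morse_seq_even morse_seq_odd) simp
qed

lemma morse_seq_two_sided_middle:
  "morse_seq_two_sided (4 * i + 1) = morse_seq_two_sided (4 * i + 2)"
proof (cases i rule: int_cases_neg)
  case (1 n)
  then show ?thesis
    using morse_seq_two_sided_of_nat [of "4 * n + 1"] morse_seq_two_sided_of_nat [of "4 * n + 2"]
      morse_seq_middle [of n]
    by (simp add: algebra_simps)
next
  case (2 n)
  have "4 * i + 1 = - 1 - int (4 * n + 2)" "4 * i + 2 = - 1 - int (4 * n + 1)"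
    by (simp_all add: 2)
  then show ?thesis
    by (simp only: morse_seq_two_sided_neg morse_seq_middle)
qed

text \<open>
  The word \<open>M(2k)\<close> is a palindrome, so that the two-sided sequence reads \<open>M(2k) M(2k)\<close> around the
  origin; the same word occurs at position \<open>5 * 4 ^ k\<close>, because the symbols of \<open>M\<close> at positions 5
  and 6 are both 0.
\<close>
lemma morse_seq_two_sided_return:
  assumes "- (4 ^ k) \<le> m" "m < 4 ^ k"
  shows "morse_seq_two_sided (m + 6 * 4 ^ k) = morse_seq_two_sided m"
proof (cases m rule: int_cases_neg)
  have pow: "(4::nat) ^ k = 2 ^ (2 * k)"
    by (simp add: power_mult)
  have m56: "\<not> morse_seq 5" "\<not> morse_seq 6"
    using morse_seq_odd [of 2] morse_seq_even [of 3] morse_seq_even [of 1] morse_seq_odd [of 1]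
      morse_seq_odd [of 0] morse_seq_0
    by (simp_all add: eval_nat_numeral)
  {
    case (1 n)
    then have n: "n < 4 ^ k"
      using assms(2) of_nat_less_iff [of n "4 ^ k", where 'a = int] by simp
    have "m + 6 * 4 ^ k = int (6 * 4 ^ k + n)"
      by (simp add: 1)
    then have "morse_seq_two_sided (m + 6 * 4 ^ k) = morse_seq (6 * 4 ^ k + n)"
      by (simp only: morse_seq_two_sided_of_nat)
    also have "\<dots> = morse_seq n"
      using morse_seq_block [of n "2 * k" 6] n m56 by (simp add: pow)
    finally show ?thesis by (simp add: 1)
  next
    case (2 n)
    have "int n < 4 ^ k"
      using assms(1) unfolding 2 by linarith
    then have n: "n < 4 ^ k"
      using of_nat_less_iff [of n "4 ^ k", where 'a = int] by simp
    \<comment> \<open>The left half of the window lands in block number 5, read from its end. The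
      reflection below leaves the symbol unchanged because \<open>2 * k\<close> is even.\<close>
    have "m + 6 * 4 ^ k = int (5 * 4 ^ k + (4 ^ k - 1 - n))"
      using n by (simp add: 2 of_nat_diff)
    then have "morse_seq_two_sided (m + 6 * 4 ^ k) = morse_seq (5 * 4 ^ k + (4 ^ k - 1 - n))"
      by (simp only: morse_seq_two_sided_of_nat)
    also have "\<dots> = morse_seq (4 ^ k - 1 - n)"
      using morse_seq_block [of "4 ^ k - 1 - n" "2 * k" 5] n m56 by (simp add: pow)
    also have "\<dots> = morse_seq n"
      using morse_seq_reflect [of n "2 * k"] n by (simp add: pow)
    finally show ?thesis by (simp add: 2)
  }
qed

section \<open>Counting in sequences that split into unequal pairs\<close>

text \<open>Each complete pair contributes exactly one 1; only an unfinished last pair leaves an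
  error of 1/2.\<close>

lemma sum_unequal_pairs:
  fixes y :: "nat \<Rightarrow> bool"
  assumes "\<And>i. y (2 * i) \<noteq> y (2 * i + 1)"
  shows "\<bar>(\<Sum>i<n. of_bool (y i)) - real n / 2\<bar> \<le> 1 / 2"
proof -
  have even: "(\<Sum>i<2 * k. of_bool (y i)) = real k" for k
  proof (induction k)
    case (Suc k)
    then show ?case using assms [of k] by (auto simp: of_bool_def split: if_splits)
  qed simp
  show ?thesis
  proof (cases "even n")
    case True
    then show ?thesis using even by (auto elim!: evenE)
  next
    case False
    then obtain k where "n = Suc (2 * k)" by (auto elim: oddE)
    then show ?thesis using even [of k] by (simp add: field_simps)
  qed
qed

text \<open>The unpaired first symbol contributes plus or minus 1/2 to the excess of ones, and the
  pairs after it at most 1/2 in absolute value. Hence the first symbol alone decides the sign of the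
  excess for all \<open>n\<close>; this is the source of heaviness.\<close>

lemma sum_unequal_pairs_offset:
  fixes y :: "nat \<Rightarrow> bool"
  assumes "\<And>i. y (2 * i + 1) \<noteq> y (2 * i + 2)"
  shows "\<bar>(\<Sum>i<n. of_bool (y i)) - real n / 2\<bar> \<le> 1"
    and "y 0 \<Longrightarrow> real n / 2 \<le> (\<Sum>i<n. of_bool (y i))"
    and "\<not> y 0 \<Longrightarrow> (\<Sum>i<n. of_bool (y i)) \<le> real n / 2"
proof -
  have "\<bar>(\<Sum>i<n. of_bool (y i)) - real n / 2\<bar> \<le> 1 \<and>
      (y 0 \<longrightarrow> real n / 2 \<le> (\<Sum>i<n. of_bool (y i))) \<and>
      (\<not> y 0 \<longrightarrow> (\<Sum>i<n. of_bool (y i)) \<le> real n / 2)"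
  proof (cases n)
    case (Suc k)
    have "\<bar>(\<Sum>i<k. of_bool (y (Suc i))) - real k / 2\<bar> \<le> 1 / 2"
      using assms by (intro sum_unequal_pairs) simp
    then show ?thesis
      by (auto simp: Suc sum.lessThan_Suc_shift field_simps abs_le_iff simp del: sum.lessThan_Suc)
  qed simp
  then show "\<bar>(\<Sum>i<n. of_bool (y i)) - real n / 2\<bar> \<le> 1"
    and "y 0 \<Longrightarrow> real n / 2 \<le> (\<Sum>i<n. of_bool (y i))"
    and "\<not> y 0 \<Longrightarrow> (\<Sum>i<n. of_bool (y i)) \<le> real n / 2"
    by auto
qed

section \<open>Orbit closures and invariant measures\<close>

lemma shift_funpow: "(shift ^^ n) \<omega> = (\<lambda>i :: 'i::semiring_1. \<omega> (i + of_nat n))"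
  by (induction n) (auto simp: shift_def algebra_simps)

text \<open>Splitting on the value of the first coordinate reduces this to single coordinates, where
  \<open>bool\<close> is discrete. It carries properties from the orbit to its closure and also
  yields measurability.\<close>

lemma closed_coordinate_predicate:
  fixes P :: "bool \<Rightarrow> bool \<Rightarrow> bool"
  shows "closed {\<omega> :: 'i \<Rightarrow> bool. P (\<omega> i) (\<omega> j)}"
proof -
  have coord: "closed {\<omega> :: 'i \<Rightarrow> bool. Q (\<omega> i)}" for i and Q :: "bool \<Rightarrow> bool"
  proof -
    have "closed (Collect Q)"
      unfolding closed_def by (rule discrete_topology_class.open_discrete)
    from closed_vimage [OF this continuous_on_product_coordinates [of i]] show ?thesis
      by (simp add: vimage_def)
  qed
  have "{\<omega> :: 'i \<Rightarrow> bool. P (\<omega> i) (\<omega> j)} =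
      {\<omega>. (\<omega> i \<and> P True (\<omega> j)) \<or> (\<not> \<omega> i \<and> P False (\<omega> j))}"
    by (rule Collect_cong) (metis (full_types))
  also have "closed \<dots>"
    by (intro closed_Collect_disj closed_Collect_conj coord coord [where Q = "\<lambda>a. a"])
  finally show ?thesis .
qed

lemma forward_orbit_closure_minimal:
  assumes "closed C" "\<And>n. (T ^^ n) x \<in> C"
  shows "forward_orbit_closure T x \<subseteq> C"
  unfolding forward_orbit_closure_def using assms by (intro closure_minimal) auto

section \<open>Iterates of a measure-preserving map\<close>

lemma measure_preserving_funpow:
  assumes "T \<in> measurable \<mu> \<mu>" "distr \<mu> \<mu> T = \<mu>"
  shows "T ^^ n \<in> measurable \<mu> \<mu> \<and> distr \<mu> \<mu> (T ^^ n) = \<mu>"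
proof (induction n)
  case (Suc n)
  then have "distr \<mu> \<mu> (T \<circ> T ^^ n) = distr (distr \<mu> \<mu> (T ^^ n)) \<mu> T"
    using assms(1) by (intro distr_distr [symmetric]) auto
  moreover have "T \<circ> T ^^ n \<in> measurable \<mu> \<mu>"
    using Suc assms(1) by (blast intro: measurable_comp)
  ultimately show ?case
    using Suc assms(2) by (simp only: funpow.simps)
qed (simp_all add: id_def)

text \<open>The first \<open>N\<close> preimages of \<open>A\<close> cover the space and all have
  the measure of \<open>A\<close>, so that \<open>1 \<le> N * prob A\<close>.\<close>

lemma (in prob_space) prob_pos_if_finitely_many_preimages_cover:
  assumes "T \<in> measurable M M" "distr M M T = M" "A \<in> events"
    and cover: "\<And>\<omega>. \<omega> \<in> space M \<Longrightarrow> \<exists>k<N. (T ^^ k) \<omega> \<in> A"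
  shows "prob A > 0"
proof -
  define B where "B k = (T ^^ k) -` A \<inter> space M" for k
  have B: "B k \<in> events" "prob (B k) = prob A" for k
    using measure_preserving_funpow [OF assms(1,2), of k] \<open>A \<in> events\<close> measure_distr [of "T ^^ k" M M A]
    by (auto simp: B_def intro: measurable_sets)
  have "space M \<subseteq> (\<Union>k<N. B k)"
    using cover by (fastforce simp: B_def)
  then have "1 \<le> prob (\<Union>k<N. B k)"
    using B(1) by (subst prob_space [symmetric], intro finite_measure_mono) auto
  also have "\<dots> \<le> (\<Sum>k<N. prob (B k))"
    using B(1) by (intro finite_measure_subadditive_finite) auto
  finally have "1 \<le> real N * prob A"
    by (simp add: B(2))
  then show ?thesis
    using measure_nonneg [of M A] by (cases "prob A = 0") (simp_all add: less_le)
qed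

text \<open>By invariance the Birkhoff sum of length \<open>n\<close> has integral \<open>n\<close>
  times that of \<open>f\<close>. The bound then makes \<open>n\<close> times the difference of the
  integral and \<open>c\<close> bounded in \<open>n\<close>.\<close>

lemma (in prob_space) integral_eq_if_birkhoff_sum_bounded:
  fixes f :: "'a \<Rightarrow> real"
  assumes T: "T \<in> measurable M M" "distr M M T = M" and f: "integrable M f"
    and bound: "\<And>n \<omega>. \<omega> \<in> space M \<Longrightarrow> \<bar>birkhoff_sum T f n \<omega> - real n * c\<bar> \<le> b"
  shows "(\<integral>\<omega>. f \<omega> \<partial>M) = c"
proof (rule ccontr)
  let ?I = "\<integral>\<omega>. f \<omega> \<partial>M"
  assume "?I \<noteq> c"
  have f_iter: "integrable M (\<lambda>\<omega>. f ((T ^^ i) \<omega>))" "(\<integral>\<omega>. f ((T ^^ i) \<omega>) \<partial>M) = ?I" for i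
    using measure_preserving_funpow [OF T, of i] f
      integrable_distr_eq [of "T ^^ i" M M f] integral_distr [of "T ^^ i" M M f] by auto
  have "\<bar>real n * (?I - c)\<bar> \<le> b" for n
  proof -
    have int: "integrable M (birkhoff_sum T f n)"
      unfolding birkhoff_sum_def using f_iter(1) by auto
    have "(\<integral>\<omega>. birkhoff_sum T f n \<omega> \<partial>M) = real n * ?I"
      unfolding birkhoff_sum_def using f_iter by (subst Bochner_Integration.integral_sum) auto
    moreover have "(\<integral>\<omega>. birkhoff_sum T f n \<omega> \<partial>M) \<le> real n * c + b"
      using bound [of _ n] by (intro integral_le_const int) (fastforce simp: abs_le_iff)
    moreover have "(\<integral>\<omega>. birkhoff_sum T f n \<omega> \<partial>M) \<ge> real n * c - b"
      using bound [of _ n] by (intro integral_ge_const int) (fastforce simp: abs_le_iff)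
    ultimately show ?thesis
      by (simp add: algebra_simps abs_le_iff)
  qed
  moreover obtain n where "b < real n * \<bar>?I - c\<bar>"
    using reals_Archimedean3 [of "\<bar>?I - c\<bar>"] \<open>?I \<noteq> c\<close> by auto
  ultimately show False
    by (simp add: abs_mult not_le [symmetric])
qed

section \<open>Heavy points\<close>

text \<open>One setting for both systems: the index type may be \<open>nat\<close> or
  \<open>int\<close>, and the Morse sequences enter only through \<open>pair\<close> and
  \<open>middle\<close>.\<close>

locale paired_system = prob_space \<mu>
  for \<mu> :: "('i::comm_semiring_1 \<Rightarrow> bool) measure" +
  fixes x :: "'i \<Rightarrow> bool"
  assumes invariant: "invariant_prob (forward_orbit_closure shift x) shift \<mu>"
    and pair: "\<And>i. x (2 * i) \<noteq> x (2 * i + 1)"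
    and middle: "\<And>i. x (4 * i + 1) = x (4 * i + 2)"
begin

definition \<Gamma> where "\<Gamma> = {\<omega> \<in> space \<mu>. \<omega> 0}"

text \<open>A measurable set inside both heavy sets, used to bound their measures from below. Over
  \<open>int\<close> every position lies in a pair, over \<open>nat\<close> position 0 stands
  alone.\<close>

definition heavy_core where
  "heavy_core = {\<omega> \<in> space \<mu>. \<omega> 0 \<and> (\<forall>i. \<omega> (2 * i + 1) \<noteq> \<omega> (2 * i + 2))}"

lemma space_eq: "space \<mu> = forward_orbit_closure shift x"
  and sets_eq: "sets \<mu> = sets (restrict_space borel (forward_orbit_closure shift x))"
  and shift_measurable: "shift \<in> measurable \<mu> \<mu>"
  and shift_invariant: "distr \<mu> \<mu> shift = \<mu>"
  using invariant sets_eq_imp_space_eq [of \<mu> "restrict_space borel (forward_orbit_closure shift x)"]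
  by (auto simp: invariant_prob_def space_restrict_space)

lemma shift_funpow_in_space: "\<omega> \<in> space \<mu> \<Longrightarrow> (\<lambda>i. \<omega> (i + of_nat n)) \<in> space \<mu>"
  using measurable_space [OF conjunct1
      [OF measure_preserving_funpow [OF shift_measurable shift_invariant]], of \<omega> n]
  by (simp only: shift_funpow)

lemma closed_in_events:
  assumes "closed {\<omega>. P \<omega>}"
  shows "{\<omega> \<in> space \<mu>. P \<omega>} \<in> events"
proof -
  have "{\<omega> \<in> space \<mu>. P \<omega>} = forward_orbit_closure shift x \<inter> {\<omega>. P \<omega>}"
    unfolding space_eq by blast
  then show ?thesis
    unfolding sets_eq sets_restrict_space using borel_closed [OF assms] by (rule image_eqI)
qed

lemma coordinate_measurable [measurable]: "Measurable.pred \<mu> (\<lambda>\<omega>. \<omega> i)"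
  using closed_in_events [OF closed_coordinate_predicate [of "\<lambda>a b. a" i i]]
  by (simp only: pred_def)

lemma \<Gamma>_in_events: "\<Gamma> \<in> events"
  unfolding \<Gamma>_def by measurable

lemma heavy_core_in_events: "heavy_core \<in> events"
  unfolding heavy_core_def
  by (intro closed_in_events closed_Collect_conj closed_Collect_all
      closed_coordinate_predicate [where P = "(\<noteq>)"] closed_coordinate_predicate [where P = "\<lambda>a b. a"])

text \<open>Shifting by \<open>n\<close> keeps the pairs at even positions or moves them to odd
  ones, according to the parity of \<open>n\<close>. The disjunction is a closed condition, so it
  passes to the closure.\<close>

lemma pairing:
  assumes "\<omega> \<in> space \<mu>"
  shows "(\<forall>i. \<omega> (2 * i) \<noteq> \<omega> (2 * i + 1)) \<or> (\<forall>i. \<omega> (2 * i + 1) \<noteq> \<omega> (2 * i + 2))"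
proof -
  let ?C = "{\<omega> :: 'i \<Rightarrow> bool. (\<forall>i. \<omega> (2 * i) \<noteq> \<omega> (2 * i + 1)) \<or> (\<forall>i. \<omega> (2 * i + 1) \<noteq> \<omega> (2 * i + 2))}"
  have "(shift ^^ n) x \<in> ?C" for n
  proof (cases "even n")
    case True
    then obtain k where "n = 2 * k" ..
    then have "2 * (i + of_nat k) = 2 * i + of_nat n"
      "2 * (i + of_nat k) + 1 = 2 * i + 1 + of_nat n" for i :: 'i
      by (simp_all add: algebra_simps)
    then have "x (2 * i + of_nat n) \<noteq> x (2 * i + 1 + of_nat n)" for i
      using pair [of "i + of_nat k"] by simp
    then show ?thesis
      unfolding shift_funpow by blast
  next
    case False
    then obtain k where "n = 2 * k + 1" by (auto elim: oddE)
    then have "2 * (i + of_nat k + 1) = 2 * i + 1 + of_nat n"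
      "2 * (i + of_nat k + 1) + 1 = 2 * i + 2 + of_nat n" for i :: 'i
      by (simp_all add: algebra_simps flip: one_add_one)
    then have "x (2 * i + 1 + of_nat n) \<noteq> x (2 * i + 2 + of_nat n)" for i
      using pair [of "i + of_nat k + 1"] by simp
    then show ?thesis
      unfolding shift_funpow by blast
  qed
  moreover have "closed ?C"
    by (intro closed_Collect_disj closed_Collect_all closed_coordinate_predicate [where P = "(\<noteq>)"])
  ultimately show ?thesis
    using forward_orbit_closure_minimal [of ?C shift x] assms by (auto simp: space_eq)
qed

text \<open>Four consecutive positions contain one congruent to 1 modulo 4, where
  \<open>middle\<close> gives equality with the successor.\<close>

lemma not_alternating:
  assumes "\<omega> \<in> space \<mu>"
  shows "\<omega> 0 = \<omega> 1 \<or> \<omega> 1 = \<omega> 2 \<or> \<omega> 2 = \<omega> 3 \<or> \<omega> 3 = \<omega> 4"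
proof -
  let ?C = "{\<omega> :: 'i \<Rightarrow> bool. \<omega> 0 = \<omega> 1 \<or> \<omega> 1 = \<omega> 2 \<or> \<omega> 2 = \<omega> 3 \<or> \<omega> 3 = \<omega> 4}"
  have "(shift ^^ n) x \<in> ?C" for n
  proof -
    \<comment> \<open>With this \<open>k\<close>, \<open>4 * k + 1\<close> is the element of
      \<open>{n..n + 3}\<close> congruent to 1 modulo 4.\<close>
    define k where "k = (n + 2) div 4"
    have "0 + n = 4 * k + 1 \<or> 1 + n = 4 * k + 1 \<or> 2 + n = 4 * k + 1 \<or> 3 + n = 4 * k + 1"
      unfolding k_def by presburger
    then obtain j where j: "j \<in> {0, 1, 2, 3}" "j + n = 4 * k + 1"
      by blast
    have "of_nat (j + n) = (4 * of_nat k + 1 :: 'i)"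
      unfolding j(2) by (simp add: add.commute)
    then have "x (of_nat j + of_nat n) = x (of_nat j + 1 + of_nat n)"
      using middle [of "of_nat k"] by (simp add: add_ac flip: one_add_one)
    with j(1) show ?thesis
      by (auto simp: shift_funpow)
  qed
  moreover have "closed ?C"
    by (intro closed_Collect_disj closed_coordinate_predicate [where P = "(=)"])
  ultimately show ?thesis
    using forward_orbit_closure_minimal [of ?C shift x] assms by (auto simp: space_eq)
qed

text \<open>
  A point with pairs at odd positions has its symbol 1 at one of the positions 0, 2, 4, because
  otherwise it begins with 01010.
\<close>
lemma heavy_core_hit:
  assumes "\<omega> \<in> space \<mu>"
  shows "\<exists>k<6. (shift ^^ k) \<omega> \<in> heavy_core"
proof -
  have offset: "\<exists>k<5. (shift ^^ k) \<omega> \<in> heavy_core"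
    if \<omega>: "\<omega> \<in> space \<mu>" and *: "\<forall>i. \<omega> (2 * i + 1) \<noteq> \<omega> (2 * i + 2)" for \<omega>
  proof -
    have in_core: "(shift ^^ (2 * k)) \<omega> \<in> heavy_core" if "\<omega> (of_nat (2 * k))" for k
    proof -
      have "2 * (i + of_nat k) + 1 = 2 * i + 1 + of_nat (2 * k)"
        "2 * (i + of_nat k) + 2 = 2 * i + 2 + of_nat (2 * k)" for i :: 'i
        by (simp_all add: algebra_simps)
      then have "\<omega> (2 * i + 1 + of_nat (2 * k)) \<noteq> \<omega> (2 * i + 2 + of_nat (2 * k))" for i
        using *[rule_format, of "i + of_nat k"] by simp
      then show ?thesis
        using that shift_funpow_in_space [OF \<omega>, of "2 * k"]
        unfolding heavy_core_def shift_funpow by (simp del: of_nat_mult)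
    qed
    have "\<omega> (1 + 0) \<noteq> \<omega> (2 + 0)" "\<omega> (1 + 2) \<noteq> \<omega> (2 + 2)"
      using *[rule_format, of 0] *[rule_format, of 1] by (simp_all add: add.commute)
    then have "\<omega> (of_nat (2 * 0)) \<or> \<omega> (of_nat (2 * 1)) \<or> \<omega> (of_nat (2 * 2))"
      using not_alternating [OF \<omega>] by auto
    then obtain k where "k < 3" "\<omega> (of_nat (2 * k))"
      by (elim disjE) (erule that [rotated], simp)+
    then show ?thesis
      using in_core [of k] by (intro exI [of _ "2 * k"]) simp
  qed
  show ?thesis
  proof (cases "\<forall>i. \<omega> (2 * i + 1) \<noteq> \<omega> (2 * i + 2)")
    case True
    then obtain k where "k < 5" "(shift ^^ k) \<omega> \<in> heavy_core"
      using offset [OF assms] by blast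
    then show ?thesis
      by (intro exI [of _ k]) simp
  next
    case False
    then have *: "\<omega> (2 * i) \<noteq> \<omega> (2 * i + 1)" for i
      using pairing [OF assms] by auto
    \<comment> \<open>One shift turns pairs at even positions into pairs at odd positions; this is
      the sixth step.\<close>
    have "\<exists>k<5. (shift ^^ k) (\<lambda>i. \<omega> (i + of_nat 1)) \<in> heavy_core"
    proof (rule offset [OF shift_funpow_in_space [OF assms]], rule allI)
      fix i :: 'i
      have "2 * (i + 1) = 2 * i + 1 + of_nat 1" "2 * (i + 1) + 1 = 2 * i + 2 + of_nat 1"
        by (simp_all add: algebra_simps flip: one_add_one)
      then show "\<omega> (2 * i + 1 + of_nat 1) \<noteq> \<omega> (2 * i + 2 + of_nat 1)"
        using *[of "i + 1"] by simp
    qed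
    then obtain k where "k < 5" "(shift ^^ Suc k) \<omega> \<in> heavy_core"
      unfolding shift_funpow by (auto simp: add_ac)
    then show ?thesis
      by (intro exI [of _ "Suc k"]) auto
  qed
qed

lemma prob_heavy_core: "prob heavy_core > 0"
  by (rule prob_pos_if_finitely_many_preimages_cover
      [OF shift_measurable shift_invariant heavy_core_in_events heavy_core_hit])

section \<open>Birkhoff sums of the indicator and the one-sided heavy set\<close>

lemma indicator_\<Gamma>: "\<omega> \<in> space \<mu> \<Longrightarrow> indicator \<Gamma> \<omega> = (of_bool (\<omega> 0) :: real)"
  by (auto simp: \<Gamma>_def indicator_def)

lemma birkhoff_sum_\<Gamma>:
  assumes "\<omega> \<in> space \<mu>"
  shows "birkhoff_sum shift (indicator \<Gamma>) n \<omega> = (\<Sum>i<n. of_bool (\<omega> (of_nat i)))"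
  using shift_funpow_in_space [OF assms]
  by (simp add: birkhoff_sum_def shift_funpow indicator_\<Gamma>)

lemma integral_\<Gamma>: "(\<integral>\<omega>. indicator \<Gamma> \<omega> \<partial>\<mu>) = (1 / 2 :: real)"
proof (rule integral_eq_if_birkhoff_sum_bounded [OF shift_measurable shift_invariant])
  show "integrable \<mu> (indicator \<Gamma> :: _ \<Rightarrow> real)"
    using \<Gamma>_in_events by (simp add: integrable_indicator_iff less_top [symmetric])
next
  fix n \<omega> assume \<omega>: "\<omega> \<in> space \<mu>"
  from pairing [OF \<omega>] show "\<bar>birkhoff_sum shift (indicator \<Gamma>) n \<omega> - real n * (1 / 2)\<bar> \<le> 1"
  proof
    assume *: "\<forall>i. \<omega> (2 * i) \<noteq> \<omega> (2 * i + 1)"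
    have "\<omega> (of_nat (2 * i)) \<noteq> \<omega> (of_nat (2 * i + 1))" for i
      using *[rule_format, of "of_nat i"] by (simp add: algebra_simps)
    from sum_unequal_pairs [of "\<lambda>i. \<omega> (of_nat i)", OF this, of n] show ?thesis
      by (simp add: birkhoff_sum_\<Gamma> [OF \<omega>])
  next
    assume *: "\<forall>i. \<omega> (2 * i + 1) \<noteq> \<omega> (2 * i + 2)"
    have "\<omega> (of_nat (2 * i + 1)) \<noteq> \<omega> (of_nat (2 * i + 2))" for i
      using * by (simp only: of_nat_add of_nat_mult of_nat_numeral of_nat_1) simp
    from sum_unequal_pairs_offset(1) [of "\<lambda>i. \<omega> (of_nat i)", OF this, of n] show ?thesis
      by (simp add: birkhoff_sum_\<Gamma> [OF \<omega>])
  qed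
qed

lemma heavy_nat_\<Gamma>:
  "heavy_nat \<mu> shift (indicator \<Gamma>) =
     {\<omega> \<in> space \<mu>. \<forall>n. real n / 2 \<le> (\<Sum>i<n. of_bool (\<omega> (of_nat i)))}"
  unfolding heavy_nat_def integral_\<Gamma> by (auto simp: birkhoff_sum_\<Gamma>)

text \<open>Monotonicity of the measure requires the larger set to be measurable.\<close>

lemma heavy_nat_in_events: "heavy_nat \<mu> shift (indicator \<Gamma>) \<in> events"
  unfolding heavy_nat_\<Gamma> of_bool_def by measurable

lemma heavy_core_subset_heavy_nat: "heavy_core \<subseteq> heavy_nat \<mu> shift (indicator \<Gamma>)"
proof
  fix \<omega> assume \<omega>: "\<omega> \<in> heavy_core"
  have "\<omega> (of_nat (2 * i + 1)) \<noteq> \<omega> (of_nat (2 * i + 2))" for i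
    using \<omega> by (simp only: heavy_core_def of_nat_add of_nat_mult of_nat_numeral of_nat_1) simp
  from sum_unequal_pairs_offset(2) [of "\<lambda>i. \<omega> (of_nat i)", OF this] \<omega>
  show "\<omega> \<in> heavy_nat \<mu> shift (indicator \<Gamma>)"
    by (auto simp: heavy_nat_\<Gamma> heavy_core_def)
qed

lemma prob_heavy_nat: "prob (heavy_nat \<mu> shift (indicator \<Gamma>)) > 0"
  using prob_heavy_core finite_measure_mono [OF heavy_core_subset_heavy_nat heavy_nat_in_events]
  by linarith

end

section \<open>The two-sided system\<close>

text \<open>The closure of a forward orbit need not be invariant under the inverse shift. Here only
  the starting point is critical, and by recurrence it is a limit of its own forward shifts by
  \<open>6 * 4 ^ k\<close>.\<close>

lemma unshift_in_morse_closure: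
  assumes "\<omega> \<in> forward_orbit_closure shift morse_seq_two_sided"
  shows "(\<lambda>i. \<omega> (i - 1)) \<in> forward_orbit_closure shift morse_seq_two_sided"
    (is "_ \<in> ?X")
proof -
  let ?C = "{\<omega> :: int \<Rightarrow> bool. (\<lambda>i. \<omega> (i - 1)) \<in> ?X}"
  let ?M = "morse_seq_two_sided"
  have closed_X: "closed ?X" and orbit: "(\<lambda>i. ?M (i + int n)) \<in> ?X" for n
    using closure_subset [of "range (\<lambda>n. (shift ^^ n) ?M)"]
    by (auto simp: forward_orbit_closure_def shift_funpow)
  have "continuous_on UNIV (\<lambda>\<omega> :: int \<Rightarrow> bool. \<lambda>i. \<omega> (i - 1))"
    by (intro continuous_on_coordinatewise_then_product) simp
  from closed_vimage [OF closed_X this]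
  have "closed ?C"
    by (simp add: vimage_def)
  moreover have "(shift ^^ n) ?M \<in> ?C" for n
  proof (cases n)
    case 0
    \<comment> \<open>Shifts by one less than the return times, which converge to the sequence
      shifted back by one.\<close>
    define y where "y k = (\<lambda>i. ?M (i + int (6 * 4 ^ k - 1)))" for k :: nat
    have "\<forall>\<^sub>F k in sequentially. y k i = ?M (i - 1)" for i
    proof (rule eventually_sequentiallyI)
      fix k assume "nat \<bar>i - 1\<bar> \<le> k"
      then have "\<bar>i - 1\<bar> \<le> int k" by simp
      also have "int k < 4 ^ k"
        using of_nat_less_iff [of k "4 ^ k", where 'a = int] power_gt_expt [of 4 k] by simp
      finally have "?M (i - 1 + 6 * 4 ^ k) = ?M (i - 1)"
        by (intro morse_seq_two_sided_return) auto
      moreover have "i + int (6 * 4 ^ k - 1) = i - 1 + 6 * 4 ^ k"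
        by (simp add: of_nat_diff)
      ultimately show "y k i = ?M (i - 1)"
        by (simp only: y_def)
    qed
    then have "(\<lambda>k. y k i) \<longlonglongrightarrow> ?M (i - 1)" for i
      by (rule tendsto_eventually)
    \<comment> \<open>Each coordinate is eventually constant, and convergence in the product
      topology is coordinatewise.\<close>
    then have "limitin (product_topology (\<lambda>_. euclidean) UNIV) y (\<lambda>i. ?M (i - 1)) sequentially"
      by (simp add: limitin_componentwise)
    then have "y \<longlonglongrightarrow> (\<lambda>i. ?M (i - 1))"
      by (simp add: euclidean_product_topology)
    then have "(\<lambda>i. ?M (i - 1)) \<in> ?X"
      by (rule Lim_in_closed_set [OF closed_X _ sequentially_bot, rotated])
        (simp only: y_def orbit eventually_True)
    then show ?thesis by (simp add: 0)
  next
    case (Suc m)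
    have "(\<lambda>i. (shift ^^ n) ?M (i - 1)) = (\<lambda>i. ?M (i + int m))"
      unfolding shift_funpow Suc by simp
    then show ?thesis using orbit [of m] by simp
  qed
  ultimately show ?thesis
    using forward_orbit_closure_minimal [of ?C shift ?M] assms by auto
qed

locale two_sided_morse_system = paired_system \<mu> morse_seq_two_sided
  for \<mu> :: "(int \<Rightarrow> bool) measure"
begin

text \<open>\<open>int_iterate\<close> inverts the shift on the space only; this is the plain
  backward shift because the space is closed under the latter.\<close>

lemma inv_into_shift:
  assumes "\<omega> \<in> space \<mu>"
  shows "inv_into (space \<mu>) shift \<omega> = (\<lambda>i. \<omega> (i - 1))"
proof (rule inv_into_f_eq)
  show "inj_on (shift :: (int \<Rightarrow> bool) \<Rightarrow> _) (space \<mu>)"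
  proof (rule inj_onI, rule ext)
    fix a b :: "int \<Rightarrow> bool" and i assume "shift a = shift b"
    then have "shift a (i - 1) = shift b (i - 1)" by simp
    then show "a i = b i" by (simp add: shift_def)
  qed
qed (use assms unshift_in_morse_closure in \<open>auto simp: space_eq shift_def\<close>)

lemma inv_into_shift_funpow:
  assumes "\<omega> \<in> space \<mu>"
  shows "(inv_into (space \<mu>) shift ^^ n) \<omega> = (\<lambda>i. \<omega> (i - int n)) \<and>
    (\<lambda>i. \<omega> (i - int n)) \<in> space \<mu>"
proof (induction n)
  case (Suc n)
  let ?\<omega> = "\<lambda>i. \<omega> (i - int n)"
  have "(\<lambda>i. ?\<omega> (i - 1)) = (\<lambda>i. \<omega> (i - int (Suc n)))"
    by (rule ext, rule arg_cong [where f = \<omega>]) simp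
  then show ?case
    using Suc inv_into_shift [of ?\<omega>] unshift_in_morse_closure [of ?\<omega>] by (simp add: space_eq)
qed (use assms in simp)

lemma int_iterate_shift:
  assumes "\<omega> \<in> space \<mu>"
  shows "int_iterate (space \<mu>) shift n \<omega> = (\<lambda>i. \<omega> (i + n))"
    and "int_iterate (space \<mu>) shift n \<omega> \<in> space \<mu>"
  using inv_into_shift_funpow [OF assms, of "nat (- n)"] shift_funpow_in_space [OF assms, of "nat n"]
  by (cases "n \<ge> 0"; simp add: int_iterate_def shift_funpow)+

lemma birkhoff_sum_int_\<Gamma>:
  assumes "\<omega> \<in> space \<mu>"
  shows "birkhoff_sum_int (space \<mu>) shift (indicator \<Gamma>) (int n) \<omega> = (\<Sum>i<n. of_bool (\<omega> (int i)))"
    and "birkhoff_sum_int (space \<mu>) shift (indicator \<Gamma>) (- int n) \<omega> =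
      - (\<Sum>i<n. of_bool (\<omega> (- 1 - int i)))"
proof -
  have ind: "indicator \<Gamma> (int_iterate (space \<mu>) shift i \<omega>) = (of_bool (\<omega> i) :: real)" for i
    using int_iterate_shift [OF assms, of i] indicator_\<Gamma> [of "int_iterate (space \<mu>) shift i \<omega>"] by simp
  have "(\<Sum>i\<in>{0..<int n}. of_bool (\<omega> i)) = (\<Sum>i<n. of_bool (\<omega> (int i)) :: real)"
    by (rule sum.reindex_bij_witness [of _ int nat]) auto
  then show "birkhoff_sum_int (space \<mu>) shift (indicator \<Gamma>) (int n) \<omega> = (\<Sum>i<n. of_bool (\<omega> (int i)))"
    by (simp add: birkhoff_sum_int_def ind)
  have "(\<Sum>i\<in>{- int n..-1}. of_bool (\<omega> i)) = (\<Sum>i<n. of_bool (\<omega> (- 1 - int i)) :: real)"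
    by (rule sum.reindex_bij_witness [of _ "\<lambda>i. - 1 - int i" "\<lambda>i. nat (- 1 - i)"]) auto
  then show "birkhoff_sum_int (space \<mu>) shift (indicator \<Gamma>) (- int n) \<omega> =
      - (\<Sum>i<n. of_bool (\<omega> (- 1 - int i)))"
    \<comment> \<open>For \<open>n = 0\<close> the definition takes its nonnegative branch.\<close>
    by (cases "n = 0") (simp_all add: birkhoff_sum_int_def ind)
qed

text \<open>At negative times both sides of the heaviness inequality carry a minus sign, so the
  condition bounds the ones to the left of the origin from above.\<close>

lemma heavy_int_\<Gamma>:
  "heavy_int \<mu> shift (indicator \<Gamma>) = heavy_nat \<mu> shift (indicator \<Gamma>) \<inter>
     {\<omega> \<in> space \<mu>. \<forall>n. (\<Sum>i<n. of_bool (\<omega> (- 1 - int i))) \<le> real n / 2}"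
proof -
  have all_int: "(\<forall>i. P i) \<longleftrightarrow> (\<forall>n. P (int n)) \<and> (\<forall>n. P (- int n))" for P
    by (metis int_cases2)
  show ?thesis
    unfolding heavy_int_def heavy_nat_\<Gamma> integral_\<Gamma>
    by (subst all_int) (auto simp: birkhoff_sum_int_\<Gamma>)
qed

lemma heavy_int_in_events: "heavy_int \<mu> shift (indicator \<Gamma>) \<in> events"
proof -
  have "{\<omega> \<in> space \<mu>. \<forall>n. (\<Sum>i<n. of_bool (\<omega> (- 1 - int i))) \<le> real n / 2} \<in> events"
    unfolding of_bool_def by measurable
  then show ?thesis
    using heavy_nat_in_events by (simp add: heavy_int_\<Gamma>)
qed

lemma heavy_core_subset_heavy_int: "heavy_core \<subseteq> heavy_int \<mu> shift (indicator \<Gamma>)"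
proof
  fix \<omega> assume \<omega>: "\<omega> \<in> heavy_core"
  then have pairs: "\<omega> (2 * i + 1) \<noteq> \<omega> (2 * i + 2)" for i
    by (auto simp: heavy_core_def)
  \<comment> \<open>Read leftwards from position -1, the point is again a lone symbol followed by
    pairs. The lone symbol is 0, being paired with the 1 at the origin.\<close>
  have "\<omega> (- 1 - int (2 * i + 1)) \<noteq> \<omega> (- 1 - int (2 * i + 2))" for i
    using pairs [of "- int i - 2"] by (simp add: algebra_simps)
  moreover have "\<not> \<omega> (- 1 - int 0)"
    using pairs [of "- 1"] \<omega> by (simp add: heavy_core_def)
  ultimately have "(\<Sum>i<n. of_bool (\<omega> (- 1 - int i))) \<le> real n / 2" for n
    by (rule sum_unequal_pairs_offset(3) [of "\<lambda>i. \<omega> (- 1 - int i)"])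
  then show "\<omega> \<in> heavy_int \<mu> shift (indicator \<Gamma>)"
    using \<omega> heavy_core_subset_heavy_nat by (auto simp: heavy_int_\<Gamma> heavy_core_def)
qed

lemma prob_heavy_int: "prob (heavy_int \<mu> shift (indicator \<Gamma>)) > 0"
  using prob_heavy_core finite_measure_mono [OF heavy_core_subset_heavy_int heavy_int_in_events]
  by linarith

lemma prob_heavy_int_le_heavy_nat:
  "prob (heavy_int \<mu> shift (indicator \<Gamma>)) \<le> prob (heavy_nat \<mu> shift (indicator \<Gamma>))"
  by (rule finite_measure_mono [OF _ heavy_nat_in_events]) (simp add: heavy_int_\<Gamma>)

end

theorem corollary4:
  shows "(\<forall>\<mu> :: (int \<Rightarrow> bool) measure.
            invariant_prob (forward_orbit_closure shift morse_seq_two_sided) shift \<mu> \<longrightarrow>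
            (let \<Gamma> = {\<omega> \<in> space \<mu>. \<omega> 0};
                 f = indicator \<Gamma>
             in measure \<mu> (heavy_nat \<mu> shift f) \<ge> measure \<mu> (heavy_int \<mu> shift f) \<and>
                measure \<mu> (heavy_int \<mu> shift f) > 0)) \<and>
         (\<forall>\<mu> :: (nat \<Rightarrow> bool) measure.
            invariant_prob (forward_orbit_closure shift morse_seq) shift \<mu> \<longrightarrow>
            (let \<Gamma> = {\<omega> \<in> space \<mu>. \<omega> 0};
                 f = indicator \<Gamma>
             in measure \<mu> (heavy_nat \<mu> shift f) > 0))"
proof (intro conjI allI impI)
  fix \<mu> :: "(int \<Rightarrow> bool) measure"
  assume inv: "invariant_prob (forward_orbit_closure shift morse_seq_two_sided) shift \<mu>"
  then interpret prob_space \<mu>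
    by (simp add: invariant_prob_def)
  interpret two_sided_morse_system \<mu>
    by unfold_locales
      (use inv morse_seq_two_sided_pair morse_seq_two_sided_middle in auto)
  show "let \<Gamma> = {\<omega> \<in> space \<mu>. \<omega> 0}; f = indicator \<Gamma>
    in measure \<mu> (heavy_nat \<mu> shift f) \<ge> measure \<mu> (heavy_int \<mu> shift f) \<and>
       measure \<mu> (heavy_int \<mu> shift f) > 0"
    using prob_heavy_int prob_heavy_int_le_heavy_nat by (simp add: \<Gamma>_def Let_def)
next
  fix \<mu> :: "(nat \<Rightarrow> bool) measure"
  assume inv: "invariant_prob (forward_orbit_closure shift morse_seq) shift \<mu>"
  then interpret prob_space \<mu>
    by (simp add: invariant_prob_def)
  interpret paired_system \<mu> morse_seq
    by unfold_locales (use inv morse_seq_middle in auto)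
  show "let \<Gamma> = {\<omega> \<in> space \<mu>. \<omega> 0}; f = indicator \<Gamma>
    in measure \<mu> (heavy_nat \<mu> shift f) > 0"
    using prob_heavy_nat by (simp add: \<Gamma>_def Let_def)
qed

end
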